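(* There exists a Tychonoff space that is $\omega\mathrm{N}$-tight but not $\omega\mathrm{D}$-tight.
   Context: For a property $\mathcal{P}$ that a subspace of a topological space may have, a space $X$ is called $\mathcal{P}$-tight if for all $x\in X$ and $A\subseteq X$ with $x\in\overline{A}$ there is $B\subseteq A$ such that $x\in\overline{B}$ and $B$ has property $\mathcal{P}$. The properties used are: $\omega\mathrm{N}$: $B$ is countable and nowhere dense in $X$; $\omega\mathrm{D}$: $B$ is countable and discrete in the subspace topology. *)

theory Defs
  imports "HOL-Analysis.Analysis"
begin

definition P_tight :: "('a topology \<Rightarrow> 'a set \<Rightarrow> bool) \<Rightarrow> 'a topology \<Rightarrow> bool" where
  "P_tight P X \<longleftrightarrow>
     (\<forall>x \<in> topspace X. \<forall>A \<subseteq> topspace X. x \<in> X closure_of A \<longrightarrow>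
        (\<exists>B \<subseteq> A. x \<in> X closure_of B \<and> P X B))"

definition nowhere_dense_in :: "'a topology \<Rightarrow> 'a set \<Rightarrow> bool" where
  "nowhere_dense_in X B \<longleftrightarrow> B \<subseteq> topspace X \<and> X interior_of (X closure_of B) = {}"

definition omegaN :: "'a topology \<Rightarrow> 'a set \<Rightarrow> bool" where
  "omegaN X B \<longleftrightarrow> countable B \<and> nowhere_dense_in X B"

(* Discreteness is intrinsic to B: B need not be closed in X. *)
definition omegaD :: "'a topology \<Rightarrow> 'a set \<Rightarrow> bool" where
  "omegaD X B \<longleftrightarrow> countable B \<and> subtopology X B = discrete_topology B"

(* The library's completely_regular_space does not include a separation axiom for points. *)
definition Tychonoff_space :: "'a topology \<Rightarrow> bool" where
  "Tychonoff_space X \<longleftrightarrow> completely_regular_space X \<and> Hausdorff_space X"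

end

theory Submission
  imports Defs
begin

text \<open>Let \<open>Y\<close> be a countable space with a point that is a limit of the remaining points but not of
  any discrete set of them, and let \<open>Z\<close> be a metric space in which every countable set is nowhere
  dense, such as the space of bounded real sequences. Since \<open>Y\<close> is countable and \<open>Z\<close> is first
  countable, \<open>Y \<times> Z\<close> is countably tight, and a countable subset of it is nowhere dense because its
  projection to \<open>Z\<close> is. The slice \<open>Y \<times> {z}\<close> shows that \<open>Y \<times> Z\<close> is not \<open>\<omega>D\<close>-tight. The space \<open>Y\<close> is
  obtained by adding a remote point, in the manner of van Douwen, to countably many copies of a
  countable crowded space with a countable base of clopen sets.\<close>

section \<open>Zero-dimensional spaces\<close>

text \<open>The indicator of the complement of a small clopen set separates a point from a closed
  set. A clopen set inside the open set given by \<open>t0\<close>, together with its complement,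
  separates two points.\<close>

lemma clopen_base_imp_Tychonoff_space:
  assumes base: "\<And>U x. openin X U \<Longrightarrow> x \<in> U \<Longrightarrow> \<exists>C. openin X C \<and> closedin X C \<and> x \<in> C \<and> C \<subseteq> U"
    and t0: "\<And>x y. x \<in> topspace X \<Longrightarrow> y \<in> topspace X \<Longrightarrow> x \<noteq> y \<Longrightarrow>
           \<exists>U. openin X U \<and> (x \<in> U \<longleftrightarrow> y \<notin> U)"
  shows "Tychonoff_space X"
  unfolding Tychonoff_space_def
proof
  show "completely_regular_space X"
    unfolding completely_regular_space_def
  proof (intro allI impI)
    fix S x assume Sx: "closedin X S \<and> x \<in> topspace X - S"
    then obtain C where C: "openin X C" "closedin X C" "x \<in> C" "C \<subseteq> topspace X - S"
      using base[of "topspace X - S" x] by (auto simp: closedin_def)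
    define f :: "'a \<Rightarrow> real" where "f y = (if y \<in> C then 0 else 1)" for y
    have "continuous_map X (top_of_set {0..1}) f"
      unfolding continuous_map_def
    proof (intro conjI allI impI)
      fix U :: "real set"
      have "{y \<in> topspace X. f y \<in> U} =
          (if 0 \<in> U then C else {}) \<union> (if 1 \<in> U then topspace X - C else {})"
        using openin_subset[OF C(1)] by (auto simp: f_def)
      then show "openin X {y \<in> topspace X. f y \<in> U}"
        using C by (auto simp: closedin_def)
    qed (auto simp: f_def)
    then show "\<exists>f. continuous_map X (top_of_set {0..1}) f \<and> f x = 0 \<and> f ` S \<subseteq> {1::real}"
      using C by (intro exI[of _ f]) (auto simp: f_def)
  qed
next
  show "Hausdorff_space X"
    unfolding Hausdorff_space_def
  proof (intro allI impI)
    fix x y assume xy: "x \<in> topspace X \<and> y \<in> topspace X \<and> x \<noteq> y"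
    then obtain U where U: "openin X U" "x \<in> U \<longleftrightarrow> y \<notin> U"
      using t0 by blast
    have sep: "\<exists>C. openin X C \<and> closedin X C \<and> u \<in> C \<and> v \<notin> C" if "u \<in> U" "v \<notin> U" for u v
      using base[OF U(1) that(1)] that(2) by blast
    show "\<exists>V W. openin X V \<and> openin X W \<and> x \<in> V \<and> y \<in> W \<and> disjnt V W"
    proof (cases "x \<in> U")
      case True
      then obtain C where "openin X C" "closedin X C" "x \<in> C" "y \<notin> C"
        using sep U(2) by blast
      then show ?thesis using xy
        by (intro exI[of _ C] exI[of _ "topspace X - C"]) (auto simp: disjnt_def closedin_def)
    next
      case False
      then obtain C where "openin X C" "closedin X C" "y \<in> C" "x \<notin> C"
        using sep U(2) by blast
      then show ?thesis using xy
        by (intro exI[of _ "topspace X - C"] exI[of _ C]) (auto simp: disjnt_def closedin_def)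
    qed
  qed
qed

section \<open>Linked families avoiding nowhere dense sets\<close>

text \<open>When \<open>B\<close> enumerates a base of nonempty open sets, this is nowhere density
  of \<open>D\<close>, expressed through indices.\<close>

definition avoidable :: "(nat \<Rightarrow> 'a set) \<Rightarrow> 'a set \<Rightarrow> bool" where
  "avoidable B D \<longleftrightarrow> (\<forall>j. \<exists>i. B i \<subseteq> B j \<and> B i \<inter> D = {})"

primrec stage :: "(nat \<Rightarrow> 'a set) \<Rightarrow> 'a set \<Rightarrow> nat \<Rightarrow> nat" where
  "stage B D 0 = 0"
| "stage B D (Suc k) = (SOME M. stage B D k \<le> M \<and>
      (\<forall>j\<le>stage B D k. \<exists>i\<le>M. B i \<subseteq> B j \<and> B i \<inter> D = {}))"

text \<open>The bound on the index keeps the union finite, hence clopen when all \<open>B i\<close>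
  are; the growth of \<open>stage\<close> makes these sets linked.\<close>

definition avoiding :: "(nat \<Rightarrow> 'a set) \<Rightarrow> 'a set \<Rightarrow> nat \<Rightarrow> 'a set" where
  "avoiding B D k = (\<Union>i \<in> {i. i \<le> stage B D k \<and> B i \<inter> D = {}}. B i)"

lemma avoiding_disjoint: "avoiding B D k \<inter> D = {}"
  by (auto simp: avoiding_def)

lemma stage_Suc:
  assumes "avoidable B D"
  shows "stage B D k \<le> stage B D (Suc k)"
    and "j \<le> stage B D k \<Longrightarrow> \<exists>i\<le>stage B D (Suc k). B i \<subseteq> B j \<and> B i \<inter> D = {}"
proof -
  let ?P = "\<lambda>M. stage B D k \<le> M \<and> (\<forall>j\<le>stage B D k. \<exists>i\<le>M. B i \<subseteq> B j \<and> B i \<inter> D = {})"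
  obtain g where g: "\<And>j. B (g j) \<subseteq> B j \<and> B (g j) \<inter> D = {}"
    using assms unfolding avoidable_def by metis
  \<comment> \<open>A sum of chosen witnesses bounds each of them, so the \<open>SOME\<close> in
    \<open>stage\<close> has a candidate.\<close>
  define M where "M = stage B D k + (\<Sum>j\<le>stage B D k. g j)"
  have "g j \<le> M" if "j \<le> stage B D k" for j
    using member_le_sum[of j "{..stage B D k}" g] that by (simp add: M_def)
  moreover have "stage B D k \<le> M" by (simp add: M_def)
  ultimately have "?P M" using g by blast
  then have "?P (stage B D (Suc k))"
    unfolding stage.simps by (rule someI[where P = ?P])
  then show "stage B D k \<le> stage B D (Suc k)"
    and "j \<le> stage B D k \<Longrightarrow> \<exists>i\<le>stage B D (Suc k). B i \<subseteq> B j \<and> B i \<inter> D = {}"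
    by blast+
qed

lemma stage_mono:
  assumes "avoidable B D" "k \<le> n"
  shows "stage B D k \<le> stage B D n"
  using lift_Suc_mono_le[of "stage B D"] stage_Suc(1)[OF assms(1)] assms(2) by blast

text \<open>Treat first the set whose next stage is smallest: the basic set found for it is then
  already taken into account by the next stage of each of the remaining sets.\<close>

lemma avoiding_linked:
  assumes "finite G" "\<And>D. D \<in> G \<Longrightarrow> avoidable B D" "\<And>D. D \<in> G \<Longrightarrow> j \<le> stage B D l"
    and "card G + l \<le> n"
  shows "\<exists>i. B i \<subseteq> B j \<and> (\<forall>D\<in>G. B i \<subseteq> avoiding B D n)"
  using assms
proof (induction "card G" arbitrary: G j l)
  case 0
  then show ?case by auto
next
  case (Suc c)
  then have "G \<noteq> {}" by auto
  then obtain D where D: "D \<in> G" "\<And>E. E \<in> G \<Longrightarrow> stage B D (Suc l) \<le> stage B E (Suc l)"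
    using ex_min_if_finite[of "(\<lambda>D. stage B D (Suc l)) ` G"] Suc.prems(1)
    by (metis (no_types, lifting) arg_min_if_finite(1) arg_min_least)
  obtain i where i: "i \<le> stage B D (Suc l)" "B i \<subseteq> B j" "B i \<inter> D = {}"
    using stage_Suc(2)[OF Suc.prems(2)[OF D(1)] Suc.prems(3)[OF D(1)]] by blast
  have c: "c = card (G - {D})" using Suc.hyps(2) D(1) Suc.prems(1) by simp
  \<comment> \<open>Passing from \<open>j\<close> to \<open>i\<close> and from \<open>l\<close> to
    \<open>Suc l\<close> costs one set of \<open>G\<close>, so \<open>card G + l\<close> is
    unchanged.\<close>
  have "\<exists>i'. B i' \<subseteq> B i \<and> (\<forall>E\<in>G - {D}. B i' \<subseteq> avoiding B E n)"
  proof (rule Suc.hyps(1)[OF c])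
    show "i \<le> stage B E (Suc l)" if "E \<in> G - {D}" for E
      using i(1) D(2)[of E] that by (meson DiffD1 le_trans)
    show "card (G - {D}) + Suc l \<le> n" using c Suc.hyps(2) Suc.prems(4) by linarith
  qed (use Suc.prems(1,2) in auto)
  then obtain i' where i': "B i' \<subseteq> B i" "\<forall>E\<in>G - {D}. B i' \<subseteq> avoiding B E n"
    by blast
  have "Suc l \<le> n" using Suc.prems(4) Suc.hyps(2) by linarith
  then have "i \<le> stage B D n"
    using i(1) stage_mono[OF Suc.prems(2)[OF D(1)]] le_trans by blast
  then have "B i \<subseteq> avoiding B D n" using i(3) by (auto simp: avoiding_def)
  then show ?case using i' i(2) by blast
qed

section \<open>A countable space with a remote point\<close>

text \<open>These are the balls of the 2-adic topology, which makes the naturals a countable crowded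
  space.\<close>

definition cyl :: "nat \<Rightarrow> nat \<Rightarrow> nat set" where
  "cyl m k = {x. x mod 2 ^ k = m mod 2 ^ k}"

definition cyls :: "nat \<Rightarrow> nat set" where
  "cyls i = (case prod_decode i of (m, k) \<Rightarrow> cyl m k)"

lemma cyls_encode: "cyls (prod_encode (m, k)) = cyl m k"
  by (simp add: cyls_def)

lemma cyls_cases: obtains m k where "cyls i = cyl m k"
  by (cases "prod_decode i") (simp add: cyls_def)

lemma self_in_cyl: "m \<in> cyl m k"
  by (simp add: cyl_def)

lemma cyl_antimono:
  assumes "k \<le> l"
  shows "cyl m l \<subseteq> cyl m k"
proof
  fix x assume "x \<in> cyl m l"
  then have "x mod 2 ^ l mod 2 ^ k = m mod 2 ^ l mod 2 ^ k" by (simp add: cyl_def)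
  then show "x \<in> cyl m k"
    using assms by (simp add: cyl_def mod_mod_cancel le_imp_power_dvd)
qed

lemma cyl_eq: "x \<in> cyl m k \<Longrightarrow> cyl x k = cyl m k"
  by (auto simp: cyl_def)

text \<open>Clopenness in the 2-adic topology, put as local constancy of membership so that
  complements are immediate.\<close>

definition clopen2 :: "nat set \<Rightarrow> bool" where
  "clopen2 W \<longleftrightarrow> (\<forall>m. \<exists>k. \<forall>x\<in>cyl m k. x \<in> W \<longleftrightarrow> m \<in> W)"

lemma clopen2_cyl: "clopen2 (cyl m k)"
  unfolding clopen2_def by (metis cyl_eq self_in_cyl)

lemma clopen2_Compl: "clopen2 W \<Longrightarrow> clopen2 (- W)"
  by (auto simp: clopen2_def)

lemma clopen2_Un:
  assumes "clopen2 V" "clopen2 W"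
  shows "clopen2 (V \<union> W)"
  unfolding clopen2_def
proof
  fix m
  obtain k l where "\<forall>x\<in>cyl m k. x \<in> V \<longleftrightarrow> m \<in> V" "\<forall>x\<in>cyl m l. x \<in> W \<longleftrightarrow> m \<in> W"
    using assms unfolding clopen2_def by meson
  then show "\<exists>k. \<forall>x\<in>cyl m k. x \<in> V \<union> W \<longleftrightarrow> m \<in> V \<union> W"
    using cyl_antimono[of k "max k l" m] cyl_antimono[of l "max k l" m]
    by (intro exI[of _ "max k l"]) (simp add: subset_iff)
qed

lemma clopen2_UNION:
  assumes "finite I" "\<And>i. i \<in> I \<Longrightarrow> clopen2 (W i)"
  shows "clopen2 (\<Union>i\<in>I. W i)"
  using assms
proof (induction I)
  case empty
  then show ?case by (simp add: clopen2_def)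
next
  case (insert i I)
  then show ?case by (simp add: clopen2_Un)
qed

lemma clopen2_INTER:
  assumes "finite I" "\<And>i. i \<in> I \<Longrightarrow> clopen2 (W i)"
  shows "clopen2 (\<Inter>i\<in>I. W i)"
  using clopen2_Compl[OF clopen2_UNION[of I "\<lambda>i. - W i"]] assms clopen2_Compl by auto

lemma clopen2_avoiding: "clopen2 (avoiding cyls D n)"
  unfolding avoiding_def
  by (rule clopen2_UNION) (simp_all add: clopen2_cyl cyls_def split: prod.split)

text \<open>The space is crowded: a ball that isolates \<open>d\<close> in \<open>D\<close> splits
  into two halves, and the half without \<open>d\<close> misses \<open>D\<close>.\<close>

lemma avoidable_discrete:
  assumes "\<And>d. d \<in> D \<Longrightarrow> \<exists>k. cyl d k \<inter> D = {d}"
  shows "avoidable cyls D"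
  unfolding avoidable_def
proof
  fix j
  obtain m k where j: "cyls j = cyl m k" by (rule cyls_cases)
  show "\<exists>i. cyls i \<subseteq> cyls j \<and> cyls i \<inter> D = {}"
  proof (cases "cyl m k \<inter> D = {}")
    case True
    then show ?thesis using j by auto
  next
    case False
    then obtain d where d: "d \<in> cyl m k" "d \<in> D" by blast
    obtain l0 where l0: "cyl d l0 \<inter> D = {d}" using assms d(2) by blast
    define l where "l = max k l0"
    have sub: "cyl d l \<subseteq> cyl d l0" "cyl d l \<subseteq> cyl m k"
      using cyl_antimono[of l0 l d] cyl_antimono[of k l d] cyl_eq[OF d(1)] by (simp_all add: l_def)
    \<comment> \<open>Residues modulo \<open>2 ^ Suc l\<close> split \<open>cyl d l\<close> in two;
      this is the half without \<open>d\<close>.\<close>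
    let ?C = "cyl (d + 2 ^ l) (Suc l)"
    have "?C \<subseteq> cyl d l"
      using cyl_antimono[of l "Suc l" "d + 2 ^ l"] by (auto simp: cyl_def)
    moreover have "d \<notin> ?C"
    proof
      assume "d \<in> ?C"
      then have "(2::nat) ^ Suc l dvd (d + 2 ^ l) - d"
        unfolding cyl_def by (metis (lifting) mem_Collect_eq mod_eq_dvd_iff_nat le_add1)
      then have "(2::nat) ^ Suc l dvd 2 ^ l" by simp
      then show False using dvd_imp_le[of "2 ^ Suc l" "2 ^ l :: nat"] by simp
    qed
    ultimately have "?C \<subseteq> cyl d l0 - {d}" "?C \<subseteq> cyls j"
      unfolding j using sub subset_trans by (simp add: subset_Diff_insert, metis)+
    moreover have "(cyl d l0 - {d}) \<inter> D = {}" using l0 by blast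
    ultimately have "cyls (prod_encode (d + 2 ^ l, Suc l)) \<subseteq> cyls j"
      "cyls (prod_encode (d + 2 ^ l, Suc l)) \<inter> D = {}"
      unfolding cyls_encode by blast+
    then show ?thesis by blast
  qed
qed

text \<open>In the union of countably many copies \<open>{n} \<times> nat\<close> of the 2-adic space, every discrete set
  is avoided by a neighbourhood of \<open>None\<close>; the trace of that neighbourhood on the \<open>n\<close>-th copy
  belongs to an \<open>n\<close>-linked family, whence finitely many of these neighbourhoods always meet.\<close>

definition remote_nbhd :: "nat \<Rightarrow> (nat \<Rightarrow> nat set) set \<Rightarrow> (nat \<times> nat) option set" where
  "remote_nbhd n0 G =
     insert None {Some (n, m) | n m. n0 \<le> n \<and> (\<forall>D\<in>G. m \<in> avoiding cyls (D n) n)}"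

text \<open>Each \<open>D\<close> codes a subset of the sum of the copies, \<open>D n\<close> being
  its trace on the \<open>n\<close>-th copy. Finiteness of \<open>G\<close> serves both clopenness
  and linkedness.\<close>

definition remote_index :: "(nat \<Rightarrow> nat set) set \<Rightarrow> bool" where
  "remote_index G \<longleftrightarrow> finite G \<and> (\<forall>D\<in>G. \<forall>n. avoidable cyls (D n))"

definition remote_open :: "(nat \<times> nat) option set \<Rightarrow> bool" where
  "remote_open U \<longleftrightarrow>
     (\<forall>n m. Some (n, m) \<in> U \<longrightarrow> (\<exists>k. \<forall>x\<in>cyl m k. Some (n, x) \<in> U)) \<and>
     (None \<in> U \<longrightarrow> (\<exists>n0 G. remote_index G \<and> remote_nbhd n0 G \<subseteq> U))"

definition remote_space :: "(nat \<times> nat) option topology" where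
  "remote_space = topology remote_open"

lemma remote_nbhd_Int: "remote_nbhd (max a b) (G \<union> H) = remote_nbhd a G \<inter> remote_nbhd b H"
  by (auto simp: remote_nbhd_def)

lemma istopology_remote_open: "istopology remote_open"
  unfolding istopology_def
proof (intro conjI allI impI)
  fix S T assume S: "remote_open S" and T: "remote_open T"
  show "remote_open (S \<inter> T)"
    unfolding remote_open_def
  proof (intro conjI allI impI)
    fix n m assume "Some (n, m) \<in> S \<inter> T"
    then obtain k l where "\<forall>x\<in>cyl m k. Some (n, x) \<in> S" "\<forall>x\<in>cyl m l. Some (n, x) \<in> T"
      using S T unfolding remote_open_def by blast
    then show "\<exists>k. \<forall>x\<in>cyl m k. Some (n, x) \<in> S \<inter> T"
      using cyl_antimono[of k "max k l" m] cyl_antimono[of l "max k l" m]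
      by (intro exI[of _ "max k l"]) (simp add: subset_iff)
  next
    assume "None \<in> S \<inter> T"
    then obtain a G b H where "remote_index G" "remote_nbhd a G \<subseteq> S" "remote_index H" "remote_nbhd b H \<subseteq> T"
      using S T unfolding remote_open_def by blast
    then have "remote_index (G \<union> H)" "remote_nbhd (max a b) (G \<union> H) \<subseteq> S \<inter> T"
      by (auto simp: remote_nbhd_Int remote_index_def)
    then show "\<exists>n0 G. remote_index G \<and> remote_nbhd n0 G \<subseteq> S \<inter> T" by blast
  qed
next
  fix K assume "\<forall>S\<in>K. remote_open S"
  then show "remote_open (\<Union>K)"
    unfolding remote_open_def by (meson Union_iff Union_upper subset_trans)
qed

lemma openin_remote_space: "openin remote_space U \<longleftrightarrow> remote_open U"
  by (simp add: remote_space_def istopology_remote_open topology_inverse')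

lemma remote_index_empty: "remote_index {}"
  by (simp add: remote_index_def)

lemma topspace_remote_space: "topspace remote_space = UNIV"
proof -
  have "openin remote_space UNIV"
    using remote_index_empty by (auto simp: openin_remote_space remote_open_def)
  then show ?thesis using openin_subset by blast
qed

section \<open>A clopen base for the space with the remote point\<close>

lemma clopenin_cylinder:
  shows "openin remote_space ((\<lambda>x. Some (n, x)) ` cyl m k)"
    and "closedin remote_space ((\<lambda>x. Some (n, x)) ` cyl m k)"
proof -
  show "openin remote_space ((\<lambda>x. Some (n, x)) ` cyl m k)"
    using cyl_eq by (fastforce simp: openin_remote_space remote_open_def)
  have "\<exists>l. \<forall>x\<in>cyl y l. x \<notin> cyl m k" if "y \<notin> cyl m k" for y
    using that clopen2_cyl[of m k] unfolding clopen2_def by blast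
  \<comment> \<open>The threshold \<open>Suc n\<close> keeps this neighbourhood of
    \<open>None\<close> off the \<open>n\<close>-th copy.\<close>
  moreover have "remote_nbhd (Suc n) {} \<subseteq> - (\<lambda>x. Some (n, x)) ` cyl m k"
    by (auto simp: remote_nbhd_def)
  ultimately have "remote_open (- (\<lambda>x. Some (n, x)) ` cyl m k)"
    using remote_index_empty unfolding remote_open_def by blast
  then show "closedin remote_space ((\<lambda>x. Some (n, x)) ` cyl m k)"
    by (simp add: closedin_def topspace_remote_space openin_remote_space Compl_eq_Diff_UNIV)
qed

text \<open>From \<open>n0\<close> on, the trace on each copy is a finite intersection of clopen
  sets. The complement omits \<open>None\<close>, so its openness is tested on the copies
  only.\<close>

lemma clopenin_remote_nbhd:
  assumes "remote_index G"
  shows "openin remote_space (remote_nbhd n0 G)" "closedin remote_space (remote_nbhd n0 G)"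
proof -
  have cl: "\<exists>k. \<forall>x\<in>cyl m k. (\<forall>D\<in>G. x \<in> avoiding cyls (D n) n) \<longleftrightarrow> (\<forall>D\<in>G. m \<in> avoiding cyls (D n) n)" for n m
    using clopen2_INTER[of G "\<lambda>D. avoiding cyls (D n) n"] assms clopen2_avoiding
    unfolding clopen2_def remote_index_def by simp
  have "\<exists>k. \<forall>x\<in>cyl m k. Some (n, x) \<in> remote_nbhd n0 G \<longleftrightarrow> Some (n, m) \<in> remote_nbhd n0 G" for n m
    using cl[of m n] by (simp add: remote_nbhd_def) blast
  then have "remote_open (remote_nbhd n0 G)" "remote_open (- remote_nbhd n0 G)"
    using assms unfolding remote_open_def by (auto simp: remote_nbhd_def) blast+
  then show "openin remote_space (remote_nbhd n0 G)" "closedin remote_space (remote_nbhd n0 G)"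
    by (auto simp: closedin_def topspace_remote_space openin_remote_space Compl_eq_Diff_UNIV)
qed

lemma Tychonoff_space_remote_space: "Tychonoff_space remote_space"
proof (rule clopen_base_imp_Tychonoff_space)
  fix U x assume U: "openin remote_space U" and x: "x \<in> U"
  show "\<exists>C. openin remote_space C \<and> closedin remote_space C \<and> x \<in> C \<and> C \<subseteq> U"
  proof (cases x)
    case None
    then obtain n0 G where "remote_index G" "remote_nbhd n0 G \<subseteq> U"
      using U x unfolding openin_remote_space remote_open_def by blast
    then show ?thesis using None clopenin_remote_nbhd
      by (intro exI[of _ "remote_nbhd n0 G"]) (auto simp: remote_nbhd_def)
  next
    case (Some p)
    then obtain n m where nm: "x = Some (n, m)" by (cases p) auto
    then obtain k where "\<forall>y\<in>cyl m k. Some (n, y) \<in> U"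
      using U x unfolding openin_remote_space remote_open_def by blast
    then show ?thesis using nm clopenin_cylinder self_in_cyl
      by (intro exI[of _ "(\<lambda>y. Some (n, y)) ` cyl m k"]) auto
  qed
next
  fix x y :: "(nat \<times> nat) option" assume xy: "x \<noteq> y"
  have sep: "\<exists>U. openin remote_space U \<and> Some (n, m) \<in> U \<and> z \<notin> U" if "z \<noteq> Some (n, m)" for n m z
  proof -
    have "Some (n, m) \<in> (\<lambda>x. Some (n, x)) ` cyl m k" for k
      using self_in_cyl by blast
    moreover have "\<exists>k. z \<notin> (\<lambda>x. Some (n, x)) ` cyl m k"
    proof (cases "\<exists>m'. z = Some (n, m')")
      case True
      then obtain m' where m': "z = Some (n, m')" by blast
      \<comment> \<open>Both numbers lie below the modulus, so different numbers have different
        residues.\<close>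
      have "m' < 2 ^ (m + m')" "m < 2 ^ (m + m')"
        by (meson le_add1 le_add2 less_exp order_less_le_trans power_increasing one_le_numeral)+
      then have "m' \<notin> cyl m (m + m')" using that m' by (simp add: cyl_def)
      then show ?thesis using m' by auto
    qed auto
    ultimately show ?thesis using clopenin_cylinder(1) by blast
  qed
  show "\<exists>U. openin remote_space U \<and> (x \<in> U \<longleftrightarrow> y \<notin> U)"
  proof (cases x)
    case None
    then obtain n m where "y = Some (n, m)" using xy by (cases y) auto
    then show ?thesis using sep[of x n m] xy by blast
  next
    case (Some p)
    then obtain n m where "x = Some (n, m)" by (cases p) auto
    then show ?thesis using sep[of y n m] xy by blast
  qed
qed

text \<open>A neighbourhood given by \<open>n0\<close> and \<open>G\<close> meets the
  \<open>n\<close>-th copy once \<open>n\<close> is at least \<open>n0\<close> and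
  \<open>card G\<close>, since the traces there are \<open>n\<close>-linked.\<close>

lemma remote_point_in_closure: "None \<in> remote_space closure_of (range Some)"
proof -
  have "\<exists>y\<in>range Some. y \<in> U" if U: "None \<in> U" "remote_open U" for U
  proof -
    obtain n0 G where G: "remote_index G" "remote_nbhd n0 G \<subseteq> U"
      using U unfolding remote_open_def by blast
    define n where "n = max n0 (card G)"
    have "finite G" using G by (simp add: remote_index_def)
    then have "card ((\<lambda>D. D n) ` G) + 0 \<le> n"
      using card_image_le[of G "\<lambda>D. D n"] by (simp add: n_def)
    \<comment> \<open>Every \<open>stage\<close> starts at 0, so \<open>cyls 0\<close> is an
      admissible start with \<open>l = 0\<close>.\<close>
    then have "\<exists>i. cyls i \<subseteq> cyls 0 \<and> (\<forall>E\<in>(\<lambda>D. D n) ` G. cyls i \<subseteq> avoiding cyls E n)"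
      using G(1) unfolding remote_index_def by (intro avoiding_linked[where l = 0]) auto
    then obtain i where i: "\<forall>D\<in>G. cyls i \<subseteq> avoiding cyls (D n) n" by auto
    obtain m k where "cyls i = cyl m k" by (rule cyls_cases)
    then have "Some (n, m) \<in> remote_nbhd n0 G"
      using i self_in_cyl[of m k] by (auto simp: remote_nbhd_def n_def)
    then show ?thesis using G(2) by blast
  qed
  then show ?thesis
    by (simp add: in_closure_of topspace_remote_space openin_remote_space)
qed

text \<open>The traces of \<open>D\<close> on the copies are discrete, hence avoidable, so their
  sequence \<open>E\<close> alone indexes a neighbourhood of \<open>None\<close> that misses
  \<open>D\<close>.\<close>

lemma remote_point_not_in_closure_discrete:
  assumes D: "D \<subseteq> range Some"
    and disc: "\<And>d. d \<in> D \<Longrightarrow> \<exists>U. openin remote_space U \<and> U \<inter> D = {d}"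
  shows "None \<notin> remote_space closure_of D"
proof -
  define E where "E n = {m. Some (n, m) \<in> D}" for n
  have "avoidable cyls (E n)" for n
  proof (rule avoidable_discrete)
    fix d assume d: "d \<in> E n"
    then obtain U where U: "remote_open U" "U \<inter> D = {Some (n, d)}"
      using disc unfolding E_def openin_remote_space by blast
    then obtain k where "\<forall>x\<in>cyl d k. Some (n, x) \<in> U"
      unfolding remote_open_def by blast
    then have "Some (n, x) \<in> U \<inter> D" if "x \<in> cyl d k \<inter> E n" for x
      using that by (simp add: E_def)
    then have "cyl d k \<inter> E n = {d}" using U(2) d self_in_cyl[of d k] by auto
    then show "\<exists>k. cyl d k \<inter> E n = {d}" by blast
  qed
  then have "openin remote_space (remote_nbhd 0 {E})"
    by (intro clopenin_remote_nbhd) (simp add: remote_index_def)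
  moreover have "remote_nbhd 0 {E} \<inter> D = {}"
    using D avoiding_disjoint[of cyls] by (fastforce simp: remote_nbhd_def E_def)
  moreover have "None \<in> remote_nbhd 0 {E}" by (simp add: remote_nbhd_def)
  ultimately show ?thesis unfolding in_closure_of by blast
qed

section \<open>Products with a nowhere separable metric space\<close>

lemma omegaD_imp_isolated:
  assumes "omegaD X B" "b \<in> B"
  shows "\<exists>U. openin X U \<and> U \<inter> B = {b}"
proof -
  have "openin (subtopology X B) {b}" using assms by (simp add: omegaD_def)
  then show ?thesis unfolding openin_subtopology by blast
qed

text \<open>A discrete subset of the slice over \<open>c\<close> projects to a discrete subset of
  \<open>range Some\<close>, whose closure cannot contain \<open>None\<close>.\<close>

lemma not_P_tight_omegaD_prod:
  fixes c :: "'c::topological_space"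
  shows "\<not> P_tight omegaD (prod_topology remote_space (euclidean :: 'c topology))"
proof
  let ?X = "prod_topology remote_space (euclidean :: 'c topology)"
  assume tight: "P_tight omegaD ?X"
  have "(None, c) \<in> ?X closure_of (range Some \<times> {c})"
    using remote_point_in_closure closure_of_subset[of "{c}" "euclidean :: 'c topology"]
    by (auto simp: closure_of_Times)
  then obtain B where B: "B \<subseteq> range Some \<times> {c}" "(None, c) \<in> ?X closure_of B" "omegaD ?X B"
    using tight unfolding P_tight_def by (auto simp: topspace_remote_space) blast
  let ?D = "fst ` B"
  have BD: "B = ?D \<times> {c}" using B(1) by force
  have "\<exists>U. openin remote_space U \<and> U \<inter> ?D = {d}" if "d \<in> ?D" for d
  proof -
    have "(d, c) \<in> B" using that BD by auto
    then obtain U where U: "openin ?X U" "U \<inter> B = {(d, c)}"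
      using omegaD_imp_isolated[OF B(3)] by blast
    then have "(d, c) \<in> U" by blast
    then obtain V W where V: "openin remote_space V" "d \<in> V" "c \<in> W" "V \<times> W \<subseteq> U"
      using U(1) unfolding openin_prod_topology_alt by blast
    \<comment> \<open>All points of \<open>B\<close> have second coordinate \<open>c\<close>, so the
      side \<open>V\<close> of the box isolates \<open>d\<close> in the projection.\<close>
    have "V \<inter> ?D \<subseteq> {d}"
    proof
      fix e assume "e \<in> V \<inter> ?D"
      then have "(e, c) \<in> U \<inter> B" using V BD by auto
      then show "e \<in> {d}" using U(2) by simp
    qed
    then show ?thesis using V(1,2) that by blast
  qed
  then have "None \<notin> remote_space closure_of ?D"
    using B(1) by (intro remote_point_not_in_closure_discrete) auto
  then show False
    using B(2) by (subst (asm) BD) (auto simp: closure_of_Times)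
qed

text \<open>One point of \<open>A\<close> is selected for each fibre and each radius
  \<open>inverse (Suc n)\<close> where there is one. These countably many points still accumulate at
  \<open>x\<close>, and they lie in a cylinder over a countable subset of the metric factor.\<close>

lemma P_tight_omegaN_prod:
  fixes Y :: "'a topology"
  assumes Y: "countable (topspace Y)"
    and Z: "\<And>E :: 'b::metric_space set. countable E \<Longrightarrow> interior (closure E) = {}"
  shows "P_tight omegaN (prod_topology Y (euclidean :: 'b topology))"
  unfolding P_tight_def
proof (intro ballI allI impI)
  let ?X = "prod_topology Y (euclidean :: 'b topology)"
  fix x A assume "x \<in> topspace ?X" and A: "A \<subseteq> topspace ?X" and xA: "x \<in> ?X closure_of A"
  obtain y z where x: "x = (y, z)" by (cases x)
  define I where "I = {(n::nat, y'). \<exists>z'. (y', z') \<in> A \<and> dist z' z < inverse (Suc n)}"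
  have "\<forall>p\<in>I. \<exists>z'. (snd p, z') \<in> A \<and> dist z' z < inverse (Suc (fst p))"
    by (auto simp: I_def)
  then obtain c where c: "\<forall>p\<in>I. (snd p, c p) \<in> A \<and> dist (c p) z < inverse (Suc (fst p))"
    by metis
  define B where "B = (\<lambda>p. (snd p, c p)) ` I"
  have BA: "B \<subseteq> A" using c by (auto simp: B_def)
  have "I \<subseteq> UNIV \<times> topspace Y" using A by (auto simp: I_def)
  then have "countable I" using Y by (meson countable_SIGMA countable_subset uncountable_def countableI_type)
  then have cB: "countable B" by (simp add: B_def)
  have "x \<in> ?X closure_of B"
    unfolding in_closure_of
  proof (intro conjI allI impI)
    show "x \<in> topspace ?X" by fact
    fix T assume T: "x \<in> T \<and> openin ?X T"
    then have "\<exists>U V. openin Y U \<and> open V \<and> y \<in> U \<and> z \<in> V \<and> U \<times> V \<subseteq> T"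
      by (simp add: openin_prod_topology_alt x)
    then obtain U V where UV: "openin Y U" "open V" "y \<in> U" "z \<in> V" "U \<times> V \<subseteq> T"
      by blast
    obtain e where e: "e > 0" "ball z e \<subseteq> V" using UV(2,4) open_contains_ball by blast
    obtain n where n: "inverse (Suc n) < e" using reals_Archimedean[OF e(1)] by auto
    have "openin ?X (U \<times> ball z (inverse (Suc n)))"
      using UV(1) by (simp add: openin_prod_Times_iff)
    moreover have "x \<in> U \<times> ball z (inverse (Suc n))" using UV(3) x by simp
    \<comment> \<open>The point \<open>a\<close> only supplies a fibre \<open>y'\<close> in
      \<open>U\<close>; the selected point of that fibre then falls into the box.\<close>
    ultimately obtain a where "a \<in> A" "a \<in> U \<times> ball z (inverse (Suc n))"
      using xA unfolding in_closure_of by meson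
    then obtain y' z' where y': "(y', z') \<in> A" "y' \<in> U" "dist z z' < inverse (Suc n)"
      by (cases a) auto
    then have "(n, y') \<in> I" by (auto simp: I_def dist_commute)
    then have "(y', c (n, y')) \<in> B" "dist (c (n, y')) z < inverse (Suc n)"
      using c by (force simp: B_def)+
    moreover from this have "c (n, y') \<in> V" using n e(2) by (auto simp: dist_commute)
    ultimately show "\<exists>b. b \<in> B \<and> b \<in> T" using UV(5) y'(2) by blast
  qed
  moreover have "omegaN ?X B"
    unfolding omegaN_def nowhere_dense_in_def
  proof (intro conjI)
    show "countable B" by fact
    show "B \<subseteq> topspace ?X" using BA A by blast
    \<comment> \<open>Closure and interior of this larger product are computed factorwise, which
      reduces the claim to \<open>Z\<close>.\<close>
    have "B \<subseteq> topspace Y \<times> snd ` B" using BA A by force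
    then have "?X interior_of (?X closure_of B) \<subseteq>
        ?X interior_of (?X closure_of (topspace Y \<times> snd ` B))"
      by (intro interior_of_mono closure_of_mono)
    also have "\<dots> = {}"
      using Z[of "snd ` B"] cB by (simp add: closure_of_Times interior_of_Times)
    finally show "?X interior_of (?X closure_of B) = {}" by blast
  qed
  ultimately show "\<exists>B\<subseteq>A. x \<in> ?X closure_of B \<and> omegaN ?X B" using BA by blast
qed

text \<open>A ball contains a family indexed by all sets of naturals with mutual distances at least
  its radius \<open>e\<close>. Approximation within \<open>e / 2\<close> from \<open>B\<close> would
  inject the power set of the naturals into \<open>B\<close>.\<close>

lemma interior_closure_countable_bcontfun:
  fixes B :: "(nat \<Rightarrow>\<^sub>C real) set"
  assumes "countable B"
  shows "interior (closure B) = {}"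
proof (rule ccontr)
  assume "interior (closure B) \<noteq> {}"
  then obtain z where "z \<in> interior (closure B)" by blast
  then obtain e where e: "e > 0" "cball z e \<subseteq> closure B"
    using mem_interior_cball by blast
  define h :: "nat set \<Rightarrow> (nat \<Rightarrow>\<^sub>C real)"
    where "h S = Bcontfun (\<lambda>n. z n + (if n \<in> S then e else 0))" for S
  have h: "apply_bcontfun (h S) n = z n + (if n \<in> S then e else 0)" for S n
  proof -
    have "(\<lambda>n. z n + (if n \<in> S then e else 0)) \<in> bcontfun"
      by (intro plus_cont apply_bcontfun bcontfun_normI[of _ e]) (use e(1) in auto)
    then show ?thesis by (simp add: h_def Bcontfun_inverse)
  qed
  have "dist z (h S) \<le> e" for S
    using e(1) by (intro dist_bound) (auto simp: h dist_real_def)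
  then have "h S \<in> closure B" for S using e(2) by auto
  then have "\<exists>b\<in>B. dist b (h S) < e / 2" for S
    using e(1) closure_approachable by (metis half_gt_zero)
  then obtain g where g: "\<And>S. g S \<in> B" "\<And>S. dist (g S) (h S) < e / 2" by metis
  have "inj g"
  proof (rule injI)
    fix S T assume "g S = g T"
    then have "dist (h S) (h T) < e"
      using g(2)[of S] g(2)[of T] dist_triangle_half_r by metis
    then have "dist (h S n) (h T n) < e" for n
      using dist_bounded[of "h S" n "h T"] by linarith
    then have "n \<in> S \<longleftrightarrow> n \<in> T" for n
      using e(1) by (simp add: h dist_real_def split: if_splits) (smt (verit))
    then show "S = T" by blast
  qed
  then have "countable (UNIV :: nat set set)"
    using g(1) assms by (metis countable_image_inj_eq countable_subset image_subset_iff)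
  then have "range (from_nat_into (UNIV :: nat set set)) = Pow UNIV"
    by (simp add: range_from_nat_into)
  then show False
    using Cantors_theorem[of "UNIV :: nat set"] by blast
qed

section \<open>Transfer to the type of sets of reals\<close>

text \<open>Two predicates appear because the point types of \<open>X\<close> and \<open>Y\<close>
  may differ; they are instantiated by the same property at both types.\<close>

lemma P_tight_homeomorphic_map:
  assumes hom: "homeomorphic_map X Y f"
    and P: "\<And>B. B \<subseteq> topspace X \<Longrightarrow> P X B \<Longrightarrow> P' Y (f ` B)"
    and tight: "P_tight P X"
  shows "P_tight P' Y"
  unfolding P_tight_def
proof (intro ballI allI impI)
  fix y A assume y: "y \<in> topspace Y" and A: "A \<subseteq> topspace Y" and yA: "y \<in> Y closure_of A"
  have surj: "f ` topspace X = topspace Y"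
    using hom homeomorphic_imp_surjective_map by blast
  obtain A' where A': "A' \<subseteq> topspace X" "A = f ` A'"
    using A surj by (metis subset_imageE)
  have "y \<in> f ` (X closure_of A')" using yA A' homeomorphic_map_closure_of[OF hom] by blast
  then obtain x where x: "x \<in> X closure_of A'" "y = f x" by blast
  then have "x \<in> topspace X" by (simp add: in_closure_of)
  then obtain B where B: "B \<subseteq> A'" "x \<in> X closure_of B" "P X B"
    using tight x(1) A'(1) unfolding P_tight_def by blast
  have "B \<subseteq> topspace X" using B A' by blast
  then have "f x \<in> Y closure_of (f ` B)" "P' Y (f ` B)"
    using homeomorphic_map_closure_of[OF hom] B P by blast+
  then show "\<exists>B\<subseteq>A. y \<in> Y closure_of B \<and> P' Y B"
    using B(1) A'(2) x(2) by blast
qed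

lemma omegaN_homeomorphic_map:
  assumes hom: "homeomorphic_map X Y f" and "B \<subseteq> topspace X" "omegaN X B"
  shows "omegaN Y (f ` B)"
  using assms(2,3) homeomorphic_map_closure_of[OF hom, of B]
    homeomorphic_map_interior_of[OF hom, of "X closure_of B"]
    image_mono[of B "topspace X" f] homeomorphic_imp_surjective_map[OF hom]
  by (simp add: omegaN_def nowhere_dense_in_def closure_of_subset_topspace)

lemma omegaD_homeomorphic_map:
  assumes hom: "homeomorphic_map X Y f" and B: "B \<subseteq> topspace X" and D: "omegaD X B"
  shows "omegaD Y (f ` B)"
proof -
  have fB: "f ` B \<subseteq> topspace Y" using B hom homeomorphic_imp_surjective_map by blast
  then have "homeomorphic_map (discrete_topology B) (subtopology Y (f ` B)) f"
    using D homeomorphic_map_subtopologies[OF hom, of B "f ` B"] B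
    by (simp add: omegaD_def Int_absorb1)
  then have "openin (subtopology Y (f ` B)) (f ` S)" if "S \<subseteq> B" for S
    using homeomorphic_map_openness that by fastforce
  then have "openin (subtopology Y (f ` B)) {b}" if "b \<in> f ` B" for b
    using that by (metis empty_subsetI image_empty image_iff image_insert insert_subset)
  then have "subtopology Y (f ` B) = discrete_topology (f ` B)"
    using fB discrete_topology_unique[of "f ` B" "subtopology Y (f ` B)"] by (simp add: Int_absorb1)
  then show ?thesis using D by (simp add: omegaD_def)
qed

text \<open>The topology is carried to the image by pulling it back along \<open>inv f\<close>,
  restricted to \<open>range f\<close>.\<close>

lemma homeomorphic_space_of_inj:
  fixes f :: "'a \<Rightarrow> 'b"
  assumes "inj f"
  shows "\<exists>Y. homeomorphic_map X Y f"
proof -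
  let ?Y = "pullback_topology (range f) (inv f) X"
  have "homeomorphic_map X ?Y f"
  proof (rule bijective_open_imp_homeomorphic_map)
    show "continuous_map X ?Y f"
      using assms by (intro continuous_map_pullback') (auto simp: o_def)
    show "open_map X ?Y f"
      unfolding open_map_def openin_pullback_topology
    proof (intro allI impI)
      fix U assume "openin X U"
      moreover have "f ` U = inv f -` U \<inter> range f" using assms by auto
      ultimately show "\<exists>V. openin X V \<and> f ` U = inv f -` V \<inter> range f" by blast
    qed
    show "f ` topspace X = topspace ?Y"
      using assms by (auto simp: topspace_pullback_topology)
    show "inj_on f (topspace X)" using assms by (rule inj_on_subset) simp
  qed
  then show ?thesis by blast
qed

lemma Tychonoff_space_homeomorphic_map:
  assumes "homeomorphic_map X Y f" "Tychonoff_space X"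
  shows "Tychonoff_space Y"
  using assms homeomorphic_map_imp_homeomorphic_space[OF assms(1)]
    homeomorphic_Hausdorff_space homeomorphic_completely_regular_space
  unfolding Tychonoff_space_def by blast

section \<open>Coding points of the product by sets of reals\<close>

lemma ex_inj_nat_times_real: "\<exists>h :: nat \<times> real \<Rightarrow> real. inj h"
proof
  \<comment> \<open>The values of \<open>arctan\<close> fill an interval of length
    \<open>pi\<close>, less than 4, so the shifted copies are disjoint.\<close>
  let ?h = "\<lambda>(n, r). 4 * real n + arctan r"
  show "inj ?h"
  proof (rule injI, clarify)
    fix n m :: nat and r s :: real
    assume eq: "4 * real n + arctan r = 4 * real m + arctan s"
    have "\<bar>4 * real n - 4 * real m\<bar> < 4"
      using eq arctan_bounded[of r] arctan_bounded[of s] pi_less_4 by linarith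
    then have "n = m" by linarith
    then show "n = m \<and> r = s" using eq by (simp add: arctan_eq_iff)
  qed
qed

lemma ex_inj_real_set: "\<exists>f :: ('a::countable) \<times> (nat \<Rightarrow>\<^sub>C real) \<Rightarrow> real set. inj f"
proof -
  obtain h :: "nat \<times> real \<Rightarrow> real" where h: "inj h" using ex_inj_nat_times_real by blast
  \<comment> \<open>A point becomes a real sequence whose entry 0 codes the first component;
    \<open>f\<close> then takes the graph of this sequence into the reals by
    \<open>h\<close>.\<close>
  define c where "c p = case_nat (real (to_nat (fst p))) (apply_bcontfun (snd p))"
    for p :: "'a \<times> (nat \<Rightarrow>\<^sub>C real)"
  define f where "f p = h ` range (\<lambda>n. (n, c p n))" for p :: "'a \<times> (nat \<Rightarrow>\<^sub>C real)"
  have "inj f"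
  proof (rule injI)
    fix p q assume "f p = f q"
    then have "range (\<lambda>n. (n, c p n)) = range (\<lambda>n. (n, c q n))"
      by (simp add: f_def inj_image_eq_iff[OF h])
    moreover have "(n, c p n) \<in> range (\<lambda>n. (n, c p n))" for n by blast
    ultimately have c: "c p n = c q n" for n by auto
    have "fst p = fst q" using c[of 0] by (simp add: c_def)
    moreover have "snd p = snd q" using c[of "Suc n" for n] by (intro bcontfun_eqI) (simp add: c_def)
    ultimately show "p = q" by (simp add: prod_eq_iff)
  qed
  then show ?thesis by blast
qed

theorem mainTheorem3:
  shows "\<exists>X :: real set topology.
           Tychonoff_space X \<and> P_tight omegaN X \<and> \<not> P_tight omegaD X"
proof -
  let ?X = "prod_topology remote_space (euclidean :: (nat \<Rightarrow>\<^sub>C real) topology)"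
  have X: "Tychonoff_space ?X"
    using Tychonoff_space_remote_space
      metrizable_imp_completely_regular_space[OF metrizable_space_euclidean[where 'a = "nat \<Rightarrow>\<^sub>C real"]]
    by (simp add: Tychonoff_space_def completely_regular_space_prod_topology Hausdorff_space_prod_topology)
  have N: "P_tight omegaN ?X"
    by (intro P_tight_omegaN_prod interior_closure_countable_bcontfun) auto
  obtain f :: "(nat \<times> nat) option \<times> (nat \<Rightarrow>\<^sub>C real) \<Rightarrow> real set" where "inj f"
    using ex_inj_real_set by blast
  then obtain Y where f: "homeomorphic_map ?X Y f"
    using homeomorphic_space_of_inj by blast
  \<comment> \<open>Failure of tightness is transferred by contraposition, which needs the inverse
    homeomorphism.\<close>
  then obtain g where g: "homeomorphic_map Y ?X g"
    using homeomorphic_map_maps homeomorphic_maps_sym by metis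
  have "Tychonoff_space Y"
    by (rule Tychonoff_space_homeomorphic_map[OF f X])
  moreover have "P_tight omegaN Y"
    by (rule P_tight_homeomorphic_map[where P = omegaN and P' = omegaN, OF f])
      (simp_all add: N omegaN_homeomorphic_map[OF f])
  moreover have "\<not> P_tight omegaD Y"
  proof
    assume "P_tight omegaD Y"
    then have "P_tight omegaD ?X"
      by (intro P_tight_homeomorphic_map[where P = omegaD and P' = omegaD, OF g] omegaD_homeomorphic_map[OF g])
    then show False using not_P_tight_omegaD_prod by blast
  qed
  ultimately show ?thesis by blast
qed

end
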